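(* Let $T\in(0,\infty)$, $p\in(0,1)$, $\alpha,\nu\in(0,1]$, $\rho\in[0,1]$ and let $r\ge1$ be an integer. Let $q:[0,T]\to(0,1]$ be a decreasing function with $q(T)=p$ such that $$F(t)=\frac{\frac{1}{q(t)}-1}{\frac1p-1},\quad t\in[0,T],$$ is a distribution function with $F(0)=0$ and $F(T)=1$. Let $N_\rho^{\alpha,\nu}(\cdot)=\{N_\rho^{\alpha,\nu}(t):t\in[0,T]\}$ be the correlated counting process $N_\rho(\cdot)$ (see context) for which $F$ is the common distribution function of the random variables $X_n^{F,\rho}$ and the probability generating function of $M_g$ is $$g(u)=\left\{E_{\nu,1}\left(-\log^\alpha\left(\frac{1-(1-p)u}{p}\right)\right)\right\}^r,\quad |u|<\frac{1}{1-p}.$$ Then the probability generating functions $\{G_{N_\rho^{\alpha,\nu}(t)}:t\in[0,T]\}$, where $G_{N_\rho^{\alpha,\nu}(t)}(u)=\mathbb{E}\left[u^{N_\rho^{\alpha,\nu}(t)}\right]$, are, for $|u|<\frac{1}{1-p}$, $$G_{N_\rho^{\alpha,\nu}(t)}(u)=\rho\left(1-\frac{\frac{1}{q(t)}-1}{\frac{1}{p}-1}\right)+\rho\,\frac{\frac{1}{q(t)}-1}{\frac{1}{p}-1}\left\{E_{\nu,1}\left(-\log^\alpha\left(\frac{1-(1-p)u}{p}\right)\right)\right\}^r+(1-\rho)\left\{E_{\nu,1}\left(-\log^\alpha\left(\frac{1-(1-q(t))u}{q(t)}\right)\right)\right\}^r.$$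
   Context: $\log^\alpha(x)$ means $(\log x)^\alpha$. Mittag-Leffler function: $E_{\alpha,\beta}(x)=\sum_{j\ge 0}\frac{x^j}{\Gamma(\alpha j+\beta)}$. Correlated counting process: for $\rho\in[0,1]$ and $T\in(0,\infty)$, $N_\rho(t)=\sum_{n=1}^{M_g}1_{[0,t]}(X_n^{F,\rho})$, $t\in[0,T]$, where $M_g$ is a nonnegative integer valued random variable with probability generating function $g(u)=\mathbb{E}[u^{M_g}]$, and $\{X_n^{F,\rho}:n\ge1\}$ is a sequence of random variables, independent of $M_g$, with common distribution function $F$ such that $F(0)=0$, $F(T)=1$, and with common pairwise correlation coefficient $\rho$. The dependence structure is the one for which, for each $t\in[0,T]$, the law of $N_\rho(t)$ has the following probability generating function (a formula recalled from the literature and used as a standing fact about these processes): $$G_{N_\rho(t)}(u)=\rho(1-F(t))+\rho F(t)g(u)+(1-\rho)g(1-F(t)+F(t)u).$$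
   Formalization: For α<1, E[M_g] is infinite, so E[u^{M_g}] diverges for |u|>1; the formula for g is assumed, and that for G proved, only at those (complex) u with |u|<1/(1-p) where E[u^{M_g}] converges: all |u|≤1, and the whole disc if α=1. *)

theory Defs
  imports "HOL-Probability.Probability"
begin

definition mittag_leffler :: "real \<Rightarrow> real \<Rightarrow> complex \<Rightarrow> complex" where
  "mittag_leffler a b z = (\<Sum>j. z ^ j / complex_of_real (Gamma (a * real j + b)))"

(* log^a(z) = (log z)^a with principal branches.  The complex power is used on purpose: for real
   z < 1 the base Ln z is negative, and the real operation satisfies x powr 1 = |x|,
   which would be wrong already for a = 1.  Note 0 powr a = 0, so log_pow a 1 = 0. *)
definition log_pow :: "real \<Rightarrow> complex \<Rightarrow> complex" where
  "log_pow a z = Ln z powr complex_of_real a"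

definition pgf :: "'a measure \<Rightarrow> ('a \<Rightarrow> nat) \<Rightarrow> complex \<Rightarrow> complex" where
  "pgf \<Omega> K u = (\<integral>\<omega>. u ^ K \<omega> \<partial>\<Omega>)"

(* Convergence (always absolute) of the expectation E[u^K]; automatic for |u| <= 1. *)
definition pgf_exists :: "'a measure \<Rightarrow> ('a \<Rightarrow> nat) \<Rightarrow> complex \<Rightarrow> bool" where
  "pgf_exists \<Omega> K u \<longleftrightarrow> integrable \<Omega> (\<lambda>\<omega>. u ^ K \<omega>)"

definition correlation :: "'a measure \<Rightarrow> ('a \<Rightarrow> real) \<Rightarrow> ('a \<Rightarrow> real) \<Rightarrow> real" where
  "correlation \<Omega> X Y =
     (\<integral>\<omega>. (X \<omega> - (\<integral>\<omega>'. X \<omega>' \<partial>\<Omega>)) * (Y \<omega> - (\<integral>\<omega>'. Y \<omega>' \<partial>\<Omega>)) \<partial>\<Omega>) /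
     (sqrt (\<integral>\<omega>. (X \<omega> - (\<integral>\<omega>'. X \<omega>' \<partial>\<Omega>))\<^sup>2 \<partial>\<Omega>) *
      sqrt (\<integral>\<omega>. (Y \<omega> - (\<integral>\<omega>'. Y \<omega>' \<partial>\<Omega>))\<^sup>2 \<partial>\<Omega>))"

(* Only the values of F on [0,T] matter; F is understood to be 0 to the left of 0 and 1 to the
   right of T. *)
definition distribution_function_on :: "real \<Rightarrow> (real \<Rightarrow> real) \<Rightarrow> bool" where
  "distribution_function_on T F \<longleftrightarrow>
     mono_on {0..T} F \<and> (\<forall>t\<in>{0..<T}. continuous (at_right t) F) \<and> F 0 = 0 \<and> F T = 1"

definition counting_process :: "('a \<Rightarrow> nat) \<Rightarrow> (nat \<Rightarrow> 'a \<Rightarrow> real) \<Rightarrow> real \<Rightarrow> 'a \<Rightarrow> nat" where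
  "counting_process Mg X t \<omega> = (\<Sum>n = 1..Mg \<omega>. indicator {0..t} (X n \<omega>))"

(* The dependence structure of the X n enters through pgf_counting, the standard formula for the
   generating function of the process.  It is required on the closed unit disc only, where all
   the expectations exist; this already determines the law of the process at time t. *)
locale correlated_counting_process = prob_space \<Omega>
  for \<Omega> :: "'a measure" +
  fixes \<rho> T :: real and F :: "real \<Rightarrow> real"
    and Mg :: "'a \<Rightarrow> nat" and X :: "nat \<Rightarrow> 'a \<Rightarrow> real"
  assumes rho: "\<rho> \<in> {0..1}"
    and T_pos: "0 < T"
    and F_df: "distribution_function_on T F"
    and Mg_rv: "Mg \<in> measurable \<Omega> (count_space UNIV)"
    and X_rv: "\<And>n. 1 \<le> n \<Longrightarrow> X n \<in> borel_measurable \<Omega>"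
    and X_cdf: "\<And>n t. 1 \<le> n \<Longrightarrow> t \<in> {0..T} \<Longrightarrow> cdf (distr \<Omega> borel (X n)) t = F t"
    and indep: "indep_set
       {Mg -` A \<inter> space \<Omega> | A. A \<in> sets (count_space UNIV)}
       {(\<lambda>\<omega>. \<lambda>n\<in>{1..}. X n \<omega>) -` B \<inter> space \<Omega> | B. B \<in> sets (Pi\<^sub>M {1..} (\<lambda>_. borel))}"
    and corr: "\<And>m n. 1 \<le> m \<Longrightarrow> 1 \<le> n \<Longrightarrow> m \<noteq> n \<Longrightarrow> correlation \<Omega> (X m) (X n) = \<rho>"
    and pgf_counting: "\<And>t u. t \<in> {0..T} \<Longrightarrow> cmod u \<le> 1 \<Longrightarrow>
       pgf \<Omega> (counting_process Mg X t) u =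
         of_real (\<rho> * (1 - F t)) + of_real (\<rho> * F t) * pgf \<Omega> Mg u
         + of_real (1 - \<rho>) * pgf \<Omega> Mg (of_real (1 - F t) + of_real (F t) * u)"

end

theory Submission
  imports Defs "HOL-Complex_Analysis.Complex_Analysis"
begin

text \<open>
  The formula for the generating function of the process is known on the closed unit disc. If
  \<open>E[u^M]\<close> converges for some \<open>|u| > 1\<close>, the generating functions involved are power
  series that converge absolutely on the closed disc of radius \<open>|u|\<close>, so they are continuous
  there and holomorphic inside; the formula therefore extends by analytic continuation, and to
  the boundary by continuity. The closed disc is stable under \<open>u \<mapsto> 1 - F + F u\<close>, and with
  \<open>F = (1/q - 1) / (1/p - 1)\<close> this substitution turns \<open>(1 - (1 - p) u) / p\<close> into
  \<open>(1 - (1 - q) u) / q\<close>.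
\<close>

lemma (in finite_measure) pgf_exists_unit_disc:
  assumes "K \<in> measurable M (count_space UNIV)" "cmod u \<le> 1"
  shows "pgf_exists M K u"
  unfolding pgf_exists_def
proof (rule integrable_const_bound[where B = 1])
  show "(\<lambda>\<omega>. u ^ K \<omega>) \<in> borel_measurable M"
    using assms(1) by measurable
qed (use assms in \<open>auto simp: norm_power power_le_one\<close>)

lemma pgf_exists_mono:
  assumes K: "K \<in> measurable M (count_space UNIV)" and L: "L \<in> measurable M (count_space UNIV)"
    and ex: "pgf_exists M K u" and LK: "\<And>\<omega>. L \<omega> \<le> K \<omega>"
    and "cmod z \<le> cmod u" "1 \<le> cmod u"
  shows "pgf_exists M L z"
  unfolding pgf_exists_def
proof (rule Bochner_Integration.integrable_bound)
  show "integrable M (\<lambda>\<omega>. u ^ K \<omega>)"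
    using ex by (simp add: pgf_exists_def)
  show "(\<lambda>\<omega>. z ^ L \<omega>) \<in> borel_measurable M"
    using L by measurable
  show "AE \<omega> in M. norm (z ^ L \<omega>) \<le> norm (u ^ K \<omega>)"
  proof (intro AE_I2)
    fix \<omega>
    have "cmod z ^ L \<omega> \<le> cmod u ^ L \<omega>"
      using assms by (intro power_mono) auto
    also have "\<dots> \<le> cmod u ^ K \<omega>"
      using assms by (intro power_increasing) auto
    finally show "norm (z ^ L \<omega>) \<le> norm (u ^ K \<omega>)"
      by (simp add: norm_power)
  qed
qed

lemma
  assumes "finite_measure M" and K: "K \<in> measurable M (count_space UNIV)"
    and ex: "pgf_exists M K u"
  shows summable_pgf: "summable (\<lambda>k. measure M (K -` {k} \<inter> space M) * cmod u ^ k)" (is ?summable)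
    and pgf_sums: "cmod z \<le> cmod u \<Longrightarrow>
      (\<lambda>k. of_real (measure M (K -` {k} \<inter> space M)) * z ^ k) sums pgf M K z"
proof -
  interpret finite_measure M by fact
  let ?A = "\<lambda>k. K -` {k} \<inter> space M"
  have [measurable]: "?A k \<in> sets M" for k
    using K by measurable
  have int: "integrable M (\<lambda>\<omega>. cmod u ^ K \<omega>)"
    using integrable_norm[of M "\<lambda>\<omega>. u ^ K \<omega>"] ex by (simp add: pgf_exists_def norm_power)
  have *: "(\<Sum>k<n. measure M (?A k) * cmod u ^ k) \<le> (\<integral>\<omega>. cmod u ^ K \<omega> \<partial>M)" for n
  proof -
    have "(\<Sum>k<n. measure M (?A k) * cmod u ^ k) =
        (\<integral>\<omega>. (\<Sum>k<n. indicator (?A k) \<omega> * cmod u ^ k) \<partial>M)"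
      by (subst Bochner_Integration.integral_sum) (auto simp: emeasure_eq_measure)
    also have "\<dots> \<le> (\<integral>\<omega>. cmod u ^ K \<omega> \<partial>M)"
    proof (rule integral_mono)
      show "integrable M (\<lambda>\<omega>. \<Sum>k<n. indicator (?A k) \<omega> * cmod u ^ k)"
        by (intro Bochner_Integration.integrable_sum) (simp add: emeasure_eq_measure)
      fix \<omega> assume "\<omega> \<in> space M"
      then have "(\<Sum>k<n. indicator (?A k) \<omega> * cmod u ^ k) =
          (\<Sum>k<n. if k = K \<omega> then cmod u ^ k else 0)"
        by (intro sum.cong) (auto simp: indicator_def)
      then show "(\<Sum>k<n. indicator (?A k) \<omega> * cmod u ^ k) \<le> cmod u ^ K \<omega>"
        by simp
    qed (fact int)
    finally show ?thesis .
  qed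
  show summ: ?summable
    by (rule summableI_nonneg_bounded[OF _ *]) auto
  assume z: "cmod z \<le> cmod u"
  let ?f = "\<lambda>k \<omega>. indicator (?A k) \<omega> *\<^sub>R z ^ k"
  have int_f: "integrable M (?f k)" for k
    by (auto simp: emeasure_eq_measure)
  have sums: "(\<lambda>k. ?f k \<omega>) sums z ^ K \<omega>" if "\<omega> \<in> space M" for \<omega>
  proof -
    have "(\<lambda>k. ?f k \<omega>) = (\<lambda>k. if k = K \<omega> then z ^ k else 0)"
      using that by (auto simp: indicator_def)
    then show ?thesis
      using sums_single[of "K \<omega>" "\<lambda>k. z ^ k"] by simp
  qed
  have norm_f: "norm (?f k \<omega>) = indicator (?A k) \<omega> * cmod z ^ k" for k \<omega>
    by (simp add: norm_power indicator_def)
  have "(\<lambda>k. integral\<^sup>L M (?f k)) sums (\<integral>\<omega>. (\<Sum>k. ?f k \<omega>) \<partial>M)"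
  proof (rule sums_integral[OF int_f])
    show "AE \<omega> in M. summable (\<lambda>k. norm (?f k \<omega>))"
    proof (intro AE_I2)
      fix \<omega> show "summable (\<lambda>k. norm (?f k \<omega>))"
        by (rule summable_finite[of "{K \<omega>}"]) (auto simp: indicator_def)
    qed
    show "summable (\<lambda>k. \<integral>\<omega>. norm (?f k \<omega>) \<partial>M)"
    proof (rule summable_comparison_test'[OF summ])
      fix k
      have "(\<integral>\<omega>. norm (?f k \<omega>) \<partial>M) = measure M (?A k) * cmod z ^ k"
        by (simp add: norm_power)
      also have "\<dots> \<le> measure M (?A k) * cmod u ^ k"
        using z by (intro mult_left_mono power_mono) auto
      finally show "norm (\<integral>\<omega>. norm (?f k \<omega>) \<partial>M) \<le> measure M (?A k) * cmod u ^ k"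
        by simp
    qed
  qed
  moreover have "(\<integral>\<omega>. (\<Sum>k. ?f k \<omega>) \<partial>M) = pgf M K z"
    unfolding pgf_def using sums by (intro Bochner_Integration.integral_cong) (auto simp: sums_iff)
  moreover have "integral\<^sup>L M (?f k) = of_real (measure M (?A k)) * z ^ k" for k
    by (simp add: emeasure_eq_measure scaleR_conv_of_real)
  ultimately show "(\<lambda>k. of_real (measure M (?A k)) * z ^ k) sums pgf M K z"
    by simp
qed

lemma
  assumes "finite_measure M" and K: "K \<in> measurable M (count_space UNIV)"
    and ex: "pgf_exists M K u"
  shows holomorphic_on_pgf: "pgf M K holomorphic_on ball 0 (cmod u)"
    and continuous_on_pgf: "continuous_on (cball 0 (cmod u)) (pgf M K)"
proof -
  let ?c = "\<lambda>k. measure M (K -` {k} \<inter> space M)"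
  note sums = pgf_sums[OF assms]
  show "pgf M K holomorphic_on ball 0 (cmod u)"
    by (rule power_series_holomorphic[where a = "\<lambda>k. of_real (?c k)"]) (auto intro: sums)
  have "uniform_limit (cball (0 :: complex) (cmod u)) (\<lambda>n z. \<Sum>k<n. of_real (?c k) * z ^ k)
      (\<lambda>z. \<Sum>k. of_real (?c k) * z ^ k) sequentially"
  proof (rule Weierstrass_m_test[OF _ summable_pgf[OF assms]])
    fix k and z :: complex assume "z \<in> cball 0 (cmod u)"
    then show "norm (of_real (?c k) * z ^ k) \<le> ?c k * cmod u ^ k"
      by (auto simp: norm_mult norm_power intro!: mult_left_mono power_mono)
  qed
  then have "continuous_on (cball (0 :: complex) (cmod u)) (\<lambda>z. \<Sum>k. of_real (?c k) * z ^ k)"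
    by (rule uniform_limit_theorem[rotated]) (auto intro!: always_eventually continuous_intros)
  then show "continuous_on (cball 0 (cmod u)) (pgf M K)"
    by (rule continuous_on_eq) (use sums in \<open>auto simp: sums_iff\<close>)
qed

lemma holomorphic_eq_on_cball:
  fixes f g :: "complex \<Rightarrow> complex"
  assumes hol: "f holomorphic_on ball 0 R" "g holomorphic_on ball 0 R"
    and cont: "continuous_on (cball 0 R) f" "continuous_on (cball 0 R) g"
    and S: "0 < S" "S \<le> R" and eq: "\<And>z. cmod z < S \<Longrightarrow> f z = g z"
    and z: "cmod z \<le> R"
  shows "f z = g z"
proof -
  have inside: "f w - g w = 0" if "w \<in> ball 0 R" for w
  proof -
    have "ball 0 S \<subseteq> ball (0 :: complex) R"
      using S by (intro subset_ball)
    then show ?thesis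
      using analytic_continuation_open[of "ball 0 S" "ball 0 R" f g w] hol S eq that by auto
  qed
  have closure: "closure (ball 0 R) = cball (0 :: complex) R"
    using S by simp
  have "f z - g z = 0"
  proof (rule continuous_constant_on_closure[of "ball 0 R" "\<lambda>z. f z - g z"])
    show "continuous_on (closure (ball 0 R)) (\<lambda>z. f z - g z)"
      unfolding closure by (intro continuous_intros cont)
  qed (use z inside closure in auto)
  then show ?thesis
    by simp
qed

lemma counting_process_le: "counting_process Mg X t \<omega> \<le> Mg \<omega>"
proof -
  have "counting_process Mg X t \<omega> \<le> (\<Sum>n = 1..Mg \<omega>. 1)"
    unfolding counting_process_def by (intro sum_mono) (auto simp: indicator_def)
  then show ?thesis by simp
qed

lemma norm_convex_comb_one_le:
  fixes u :: complex
  assumes "0 \<le> a" "a \<le> 1" "cmod u \<le> R" "1 \<le> R"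
  shows "cmod (of_real (1 - a) + of_real a * u) \<le> R"
proof -
  have "(1 - a) *\<^sub>R 1 + a *\<^sub>R u \<in> cball 0 R"
    using assms by (intro convexD[OF convex_cball]) auto
  then show ?thesis
    by (simp add: scaleR_conv_of_real)
qed

context correlated_counting_process
begin

lemma F_range:
  assumes "t \<in> {0..T}"
  shows "0 \<le> F t" "F t \<le> 1"
proof -
  have mono: "mono_on {0..T} F" and "F 0 = 0" "F T = 1"
    using F_df by (auto simp: distribution_function_on_def)
  with mono_onD[OF mono, of 0 t] mono_onD[OF mono, of t T] assms
  show "0 \<le> F t" "F t \<le> 1" by auto
qed

lemma measurable_counting_process:
  "counting_process Mg X t \<in> measurable \<Omega> (count_space UNIV)"
proof -
  have "(\<lambda>\<omega>. \<Sum>n = 1..m. indicator {0..t} (X n \<omega>) :: nat) \<in> measurable \<Omega> (count_space UNIV)" for m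
  proof (induction m)
    case (Suc m)
    have [measurable]: "X (Suc m) \<in> borel_measurable \<Omega>"
      by (rule X_rv) simp
    show ?case
      using Suc by (simp add: indicator_def) measurable
  qed simp
  then show ?thesis
    unfolding counting_process_def[abs_def]
    by (rule measurable_compose_countable[OF _ Mg_rv])
qed

lemma
  assumes t: "t \<in> {0..T}" and ex: "pgf_exists \<Omega> Mg u"
  shows pgf_exists_counting: "pgf_exists \<Omega> (counting_process Mg X t) u"
    and pgf_exists_thinning: "pgf_exists \<Omega> Mg (of_real (1 - F t) + of_real (F t) * u)"
    and pgf_counting_extended: "pgf \<Omega> (counting_process Mg X t) u =
         of_real (\<rho> * (1 - F t)) + of_real (\<rho> * F t) * pgf \<Omega> Mg u
         + of_real (1 - \<rho>) * pgf \<Omega> Mg (of_real (1 - F t) + of_real (F t) * u)"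
proof -
  let ?N = "counting_process Mg X t" and ?a = "\<lambda>z. of_real (1 - F t) + of_real (F t) * z :: complex"
  note F = F_range[OF t]
  show exN: "pgf_exists \<Omega> ?N u"
  proof (cases "cmod u \<le> 1")
    case True
    then show ?thesis
      by (intro pgf_exists_unit_disc measurable_counting_process)
  next
    case False
    then show ?thesis
      by (intro pgf_exists_mono[OF Mg_rv measurable_counting_process ex counting_process_le]) auto
  qed
  show "pgf_exists \<Omega> Mg (?a u)"
  proof (cases "cmod u \<le> 1")
    case True
    then show ?thesis
      by (intro pgf_exists_unit_disc Mg_rv norm_convex_comb_one_le F) auto
  next
    case False
    then show ?thesis
      by (intro pgf_exists_mono[OF Mg_rv Mg_rv ex order_refl]
          norm_convex_comb_one_le F) auto
  qed
  show "pgf \<Omega> ?N u = of_real (\<rho> * (1 - F t)) + of_real (\<rho> * F t) * pgf \<Omega> Mg u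
         + of_real (1 - \<rho>) * pgf \<Omega> Mg (?a u)"
  proof (cases "cmod u \<le> 1")
    case True
    with t show ?thesis by (rule pgf_counting)
  next
    case False
    let ?R = "cmod u"
    have cball: "?a z \<in> cball 0 ?R" if "z \<in> cball 0 ?R" for z
      using norm_convex_comb_one_le[OF F, of z ?R] False that by simp
    have ball: "?a z \<in> ball 0 ?R" if z: "z \<in> ball 0 ?R" for z
    proof -
      have "cmod (?a z) \<le> max 1 (cmod z)"
        by (intro norm_convex_comb_one_le F) auto
      also have "\<dots> < ?R"
        using False z by simp
      finally show ?thesis by simp
    qed
    have fin: "finite_measure \<Omega>"
      by unfold_locales
    note hol = holomorphic_on_pgf[OF fin Mg_rv ex]
      holomorphic_on_pgf[OF fin measurable_counting_process exN]
    note cont = continuous_on_pgf[OF fin Mg_rv ex]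
      continuous_on_pgf[OF fin measurable_counting_process exN]
    have hola: "(\<lambda>z. pgf \<Omega> Mg (?a z)) holomorphic_on ball 0 ?R"
      using ball
      by (intro holomorphic_on_compose_gen[OF _ hol(1), unfolded o_def] holomorphic_intros) auto
    have conta: "continuous_on (cball 0 ?R) (\<lambda>z. pgf \<Omega> Mg (?a z))"
      using cball by (intro continuous_on_compose2[OF cont(1)] continuous_intros) auto
    show ?thesis
      using False
      by (intro holomorphic_eq_on_cball[where z = u and R = ?R and S = 1 and f = "pgf \<Omega> ?N"]
          hol cont hola conta holomorphic_intros continuous_intros pgf_counting t) auto
  qed
qed

end

theorem proposition3p1:
  fixes \<Omega> :: "'a measure" and T p \<alpha> \<nu> \<rho> :: real and r :: nat
    and q F :: "real \<Rightarrow> real" and Mg :: "'a \<Rightarrow> nat" and X :: "nat \<Rightarrow> 'a \<Rightarrow> real"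
  assumes "0 < T" and "p \<in> {0<..<1}" and "\<alpha> \<in> {0<..1}" and "\<nu> \<in> {0<..1}"
    and "\<rho> \<in> {0..1}" and "1 \<le> r"
    and "q \<in> {0..T} \<rightarrow> {0<..1}" and "antimono_on {0..T} q" and "q T = p"
    and "\<And>t. t \<in> {0..T} \<Longrightarrow> F t = (1 / q t - 1) / (1 / p - 1)"
    and "distribution_function_on T F"
    and "correlated_counting_process \<Omega> \<rho> T F Mg X"
    and "\<And>u. cmod u < 1 / (1 - p) \<Longrightarrow> pgf_exists \<Omega> Mg u \<Longrightarrow>
           pgf \<Omega> Mg u =
             (mittag_leffler \<nu> 1 (- log_pow \<alpha> ((1 - of_real (1 - p) * u) / of_real p))) ^ r"
  shows "\<forall>t\<in>{0..T}. \<forall>u. cmod u < 1 / (1 - p) \<longrightarrow> pgf_exists \<Omega> Mg u \<longrightarrow>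
           pgf_exists \<Omega> (counting_process Mg X t) u \<and>
           pgf \<Omega> (counting_process Mg X t) u =
             of_real (\<rho> * (1 - (1 / q t - 1) / (1 / p - 1)))
             + of_real (\<rho> * ((1 / q t - 1) / (1 / p - 1))) *
               (mittag_leffler \<nu> 1 (- log_pow \<alpha> ((1 - of_real (1 - p) * u) / of_real p))) ^ r
             + of_real (1 - \<rho>) *
               (mittag_leffler \<nu> 1
                  (- log_pow \<alpha> ((1 - of_real (1 - q t) * u) / of_real (q t)))) ^ r"
  proof (intro ballI allI impI)
  interpret correlated_counting_process \<Omega> \<rho> T F Mg X by fact
  fix t u
  assume t: "t \<in> {0..T}" and u: "cmod u < 1 / (1 - p)" and ex: "pgf_exists \<Omega> Mg u"
  let ?w = "of_real (1 - F t) + of_real (F t) * u :: complex"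
  have p: "0 < p" "p < 1" and q: "0 < q t" "q t \<le> 1"
    using assms(2,7) t by auto
  have "cmod ?w \<le> max 1 (cmod u)"
    by (intro norm_convex_comb_one_le F_range t) auto
  also have "\<dots> < 1 / (1 - p)"
    using p u by simp
  finally have w: "cmod ?w < 1 / (1 - p)" .
  have "(1 - p) * F t / p = (1 - q t) / q t"
    using p q by (simp add: assms(10)[OF t] field_simps)
  then have *: "of_real (1 - p) * of_real (F t) / of_real p =
      (of_real (1 - q t) / of_real (q t) :: complex)"
    by (metis of_real_divide of_real_mult)
  have "(1 - of_real (1 - p) * ?w) / of_real p =
      1 + of_real (1 - p) * of_real (F t) / of_real p * (1 - u)"
    using p by (simp add: field_simps)
  also have "\<dots> = (1 - of_real (1 - q t) * u) / of_real (q t)"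
    unfolding * using q by (simp add: field_simps)
  finally have arg: "(1 - of_real (1 - p) * ?w) / of_real p =
      (1 - of_real (1 - q t) * u) / of_real (q t)" .
  show "pgf_exists \<Omega> (counting_process Mg X t) u \<and>
           pgf \<Omega> (counting_process Mg X t) u =
             of_real (\<rho> * (1 - (1 / q t - 1) / (1 / p - 1)))
             + of_real (\<rho> * ((1 / q t - 1) / (1 / p - 1))) *
               (mittag_leffler \<nu> 1 (- log_pow \<alpha> ((1 - of_real (1 - p) * u) / of_real p))) ^ r
             + of_real (1 - \<rho>) *
               (mittag_leffler \<nu> 1
                  (- log_pow \<alpha> ((1 - of_real (1 - q t) * u) / of_real (q t)))) ^ r"
    using pgf_exists_counting[OF t ex] pgf_counting_extended[OF t ex]
    unfolding assms(13)[OF u ex] assms(13)[OF w pgf_exists_thinning[OF t ex]]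
    unfolding arg unfolding assms(10)[OF t] by blast
qed

end
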